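(* Let $n\ge2$ and let $$I=I_Z=(x_0x_n,\,x_1x_n,\,\ldots,\,x_{n-1}x_n,\,x_0x_1\cdots x_{n-1})\subseteq R=K[x_0,\ldots,x_n].$$ Then: (i) if $m,s$ are positive integers with $\frac ms\ge\frac{n^2}{n^2-n+1}$, then $I^{(m)}\subseteq I^s$; (ii) for all integers $k\ge0$, the symbolic power $I^{(n^2k)}$ is not contained in the ordinary power of $I$ with exponent $(n^2-n+1)k+1$, i.e. $I^{(n^2k)}\not\subseteq I^{(n^2-n+1)k+1}$. Consequently, $\rho(I_Z)=\rho_a(I_Z)=\frac{n^2}{n^2-n+1}$.
   Context: $K$ is an algebraically closed field of any characteristic. The ideal $I_Z$ is the ideal of the scheme $Z\subset\mathbb P^n$ consisting of $n$ general $(n-2)$-planes in an $(n-1)$-plane and one point outside that plane; its minimal primary decomposition is $I_Z=P_0\cap\cdots\cap P_{n-1}\cap P_n$ with $P_i=(x_i,x_n)$ for $0\le i\le n-1$ and $P_n=(x_0,\ldots,x_{n-1})$. For a nonzero homogeneous ideal $J\subseteq R$, the $m$-th symbolic power is $J^{(m)}=\bigcap_{P\in \mathrm{Ass}(J)}(J^mR_P\cap R)$ (with $J^{(0)}=R$). The resurgence and asymptotic resurgence are, with $m,r$ ranging over positive integers, $$\rho(J)=\sup\left\{\tfrac mr\mid J^{(m)}\not\subseteq J^r\right\},\qquad \rho_a(J)=\sup\left\{\tfrac mr\mid J^{(mt)}\not\subseteq J^{rt}\text{ for all } t\gg0\right\}.$$ *)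

theory Defs
  imports
    "HOL-Algebra.Ideal_Product"
    "HOL-Algebra.Algebraic_Closure_Type"
    "HOL-Library.Poly_Mapping"
    "HOL-Library.Extended_Real"
    "HOL-Computational_Algebra.Fraction_Field"
    "HOL-Computational_Algebra.Polynomial"
begin

text \<open>
  Commutative rings occur here as subrings \<open>A\<close> of an integral domain given by a type; \<open>ring_on A\<close>
  is the corresponding structure, to which the ideal theory of the algebra library applies.
\<close>

definition ring_on :: "'a::comm_ring_1 set \<Rightarrow> 'a ring" where
  "ring_on A = ring_of_type_algebra\<lparr>carrier := A\<rparr>"

text \<open>The zeroth power is the unit ideal \<open>A\<close>, the identity of the monoid of ideals.\<close>

definition ideal_power :: "'a::comm_ring_1 set \<Rightarrow> 'a set \<Rightarrow> nat \<Rightarrow> 'a set" where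
  "ideal_power A J m = J [^]\<^bsub>ideals_set (ring_on A)\<^esub> m"

text \<open>
  The associated primes of an ideal \<open>J\<close> are those of the module \<open>A/J\<close>: the prime ideals
  that are the annihilator \<open>(J : f)\<close> of the class of some \<open>f\<close>.
\<close>

definition assoc_primes :: "'a::comm_ring_1 set \<Rightarrow> 'a set \<Rightarrow> 'a set set" where
  "assoc_primes A J =
     {P. primeideal P (ring_on A) \<and> (\<exists>f\<in>A. P = {a \<in> A. a * f \<in> J})}"

text \<open>Since \<open>A\<close> is a domain, its localization at a prime \<open>P\<close> lies in the field of fractions.\<close>

definition localization :: "'a::idom set \<Rightarrow> 'a set \<Rightarrow> 'a fract set" where
  "localization A P = {Fract a s | a s. a \<in> A \<and> s \<in> A - P}"

definition extended_ideal :: "'a::idom set \<Rightarrow> 'a set \<Rightarrow> 'a set \<Rightarrow> 'a fract set" where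
  "extended_ideal A P J = Idl\<^bsub>ring_on (localization A P)\<^esub> ((\<lambda>a. Fract a 1) ` J)"

text \<open>
  The ambient \<open>A\<close> in the intersection matters only for the unit ideal, which has no
  associated primes. As \<open>J\<^sup>0 = A\<close>, the zeroth symbolic power is \<open>A\<close>.
\<close>

definition symbolic_power :: "'a::idom set \<Rightarrow> 'a set \<Rightarrow> nat \<Rightarrow> 'a set" where
  "symbolic_power A J m =
     A \<inter> (\<Inter>P\<in>assoc_primes A J. {a \<in> A. Fract a 1 \<in> extended_ideal A P (ideal_power A J m)})"

definition resurgence :: "'a::idom set \<Rightarrow> 'a set \<Rightarrow> ereal" where
  "resurgence A J = Sup {ereal (real m / real r) | m r. 0 < m \<and> 0 < r \<and>
     \<not> symbolic_power A J m \<subseteq> ideal_power A J r}"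

definition asymptotic_resurgence :: "'a::idom set \<Rightarrow> 'a set \<Rightarrow> ereal" where
  "asymptotic_resurgence A J = Sup {ereal (real m / real r) | m r. 0 < m \<and> 0 < r \<and>
     (\<forall>\<^sub>F t in sequentially. \<not> symbolic_power A J (m * t) \<subseteq> ideal_power A J (r * t))}"

text \<open>
  Polynomials in the variables \<open>x\<^sub>0, x\<^sub>1, \<dots>\<close>; a monomial is the finitely supported
  function giving its exponents. The polynomial ring in \<open>x\<^sub>0, \<dots>, x\<^sub>n\<close> is a subring.
\<close>

type_synonym 'k mpoly = "(nat \<Rightarrow>\<^sub>0 nat) \<Rightarrow>\<^sub>0 'k"

definition mvar :: "nat \<Rightarrow> 'k::comm_ring_1 mpoly" where
  "mvar i = Poly_Mapping.single (Poly_Mapping.single i 1) 1"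

definition polys :: "nat \<Rightarrow> 'k::comm_ring_1 mpoly set" where
  "polys n = {p. \<forall>\<mu>\<in>Poly_Mapping.keys p. Poly_Mapping.keys \<mu> \<subseteq> {..n}}"

text \<open>
  The ideal of the scheme \<open>Z\<close> in projective \<open>n\<close>-space consisting of the \<open>n\<close> coordinate
  \<open>(n-2)\<close>-planes \<open>x\<^sub>i = x\<^sub>n = 0\<close> of the hyperplane \<open>x\<^sub>n = 0\<close> together with
  the coordinate point off that hyperplane.
\<close>

definition I_Z :: "nat \<Rightarrow> 'k::field mpoly set" where
  "I_Z n = (\<Inter>i\<in>{..<n}. Idl\<^bsub>ring_on (polys n)\<^esub> {mvar i, mvar n})
             \<inter> Idl\<^bsub>ring_on (polys n)\<^esub> (mvar ` {..<n})"

end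

theory Submission
  imports Defs
begin

text \<open>
  All ideals involved are monomial. With \<open>u\<close> the exponent of \<open>x\<^sub>n\<close> and \<open>S\<close> the sum of the other
  exponents \<open>a\<^sub>i\<close>, a monomial lies in \<open>I\<^sup>r\<close> iff some \<open>c \<le> min a\<^sub>i\<close> satisfies
  \<open>r \<le> c + min u (S - n c)\<close>, and in the symbolic power \<open>I\<^sup>(\<^sup>m\<^sup>)\<close> iff \<open>a\<^sub>i + u \<ge> m\<close> for all
  \<open>i < n\<close> and \<open>S \<ge> m\<close>. Choosing \<open>c\<close> optimally gives (i). The extremal monomial has
  \<open>a\<^sub>i = n k\<close> and \<open>u = n (n - 1) k\<close>, and it gives (ii). The symbolic power is read off at the
  primes \<open>P\<^sub>i\<close>: each is associated to \<open>I\<close>, every associated prime is contained in one of them,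
  and the powers of \<open>P\<^sub>i\<close> are primary because the weight that counts the variables of \<open>P\<^sub>i\<close>
  is a valuation.
\<close>

subsection \<open>Ideals of subrings\<close>

lemma ring_on_simps [simp]:
  "carrier (ring_on A) = A" "monoid.mult (ring_on A) = (*)" "ring.add (ring_on A) = (+)"
  "monoid.one (ring_on A) = 1" "ring.zero (ring_on A) = 0"
  by (simp_all add: ring_on_def ring_of_type_algebra_def)

locale subring_on =
  fixes A :: "'a::comm_ring_1 set"
  assumes one_mem: "1 \<in> A"
    and diff_mem: "a \<in> A \<Longrightarrow> b \<in> A \<Longrightarrow> a - b \<in> A"
    and mult_mem: "a \<in> A \<Longrightarrow> b \<in> A \<Longrightarrow> a * b \<in> A"
begin

lemma zero_mem: "0 \<in> A"
  using diff_mem[OF one_mem one_mem] by simp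

lemma uminus_mem: "a \<in> A \<Longrightarrow> - a \<in> A"
  using diff_mem[OF zero_mem] by simp

lemma add_mem: "a \<in> A \<Longrightarrow> b \<in> A \<Longrightarrow> a + b \<in> A"
  using diff_mem[of a "- b"] uminus_mem by simp

lemma is_cring: "cring (ring_on A)"
proof (rule cringI)
  show "abelian_group (ring_on A)"
  proof (rule abelian_groupI)
    show "\<exists>y\<in>carrier (ring_on A). y \<oplus>\<^bsub>ring_on A\<^esub> x = \<zero>\<^bsub>ring_on A\<^esub>"
      if "x \<in> carrier (ring_on A)" for x
      using that uminus_mem by (intro bexI[of _ "- x"]) auto
  qed (auto simp: add_mem zero_mem algebra_simps)
  show "Group.comm_monoid (ring_on A)"
    by (rule comm_monoidI) (auto simp: one_mem mult_mem algebra_simps)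
qed (auto simp: algebra_simps)

lemma idealI:
  assumes "J \<subseteq> A" "0 \<in> J"
    and add: "\<And>a b. a \<in> J \<Longrightarrow> b \<in> J \<Longrightarrow> a + b \<in> J"
    and mult: "\<And>a b. a \<in> A \<Longrightarrow> b \<in> J \<Longrightarrow> a * b \<in> J"
  shows "ideal J (ring_on A)"
proof -
  interpret R: cring "ring_on A" by (rule is_cring)
  have neg: "- a \<in> J" if "a \<in> J" for a
    using mult[OF uminus_mem[OF one_mem] that] by simp
  \<comment> \<open>The subgroup axioms speak of inverses in the additive monoid, which have to be
    identified with negatives of the type.\<close>
  have inv: "inv\<^bsub>add_monoid (ring_on A)\<^esub> a = - a" if "a \<in> J" for a
    using that assms(1) neg[OF that] R.minus_equality[of "- a" a] by (auto simp: a_inv_def)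
  have "subgroup J (add_monoid (ring_on A))"
    using assms inv neg by unfold_locales auto
  moreover have "b * a \<in> J" if "a \<in> A" "b \<in> J" for a b
    using mult[OF that] by (simp add: mult.commute)
  ultimately show ?thesis
    using mult by (intro Ideal.idealI R.ring_axioms) auto
qed

end

lemma ideal_ring_onD:
  assumes "ideal J (ring_on A)"
  shows "J \<subseteq> A" "0 \<in> J" "\<And>a b. a \<in> J \<Longrightarrow> b \<in> J \<Longrightarrow> a + b \<in> J"
    "\<And>a b. a \<in> A \<Longrightarrow> b \<in> J \<Longrightarrow> a * b \<in> J"
proof -
  interpret ideal J "ring_on A" by fact
  show "J \<subseteq> A" using a_subset by simp
  show "0 \<in> J" using additive_subgroup.zero_closed[OF is_additive_subgroup] by simp
  show "a + b \<in> J" if "a \<in> J" "b \<in> J" for a b using additive_subgroup.a_closed[OF is_additive_subgroup that] by simp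
  show "a * b \<in> J" if "a \<in> A" "b \<in> J" for a b using I_l_closed[of b a] that by simp
qed

lemma ideal_power_0: "ideal_power A J 0 = A"
  by (simp add: ideal_power_def nat_pow_def ideals_set_def)

lemma ideal_power_Suc: "ideal_power A J (Suc m) = ideal_prod (ring_on A) (ideal_power A J m) J"
  by (simp add: ideal_power_def nat_pow_def ideals_set_def)

subsection \<open>Monomial ideals\<close>

text \<open>An arbitrary \<open>U\<close> is allowed; the result is an ideal once \<open>U\<close>
  is closed under adding exponent vectors. Exponents with variables beyond \<open>x\<^sub>n\<close>
  may occur in \<open>U\<close> and are discarded by \<open>polys n\<close>.\<close>

definition monomial_ideal :: "nat \<Rightarrow> (nat \<Rightarrow>\<^sub>0 nat) set \<Rightarrow> 'k::comm_ring_1 mpoly set" where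
  "monomial_ideal n U = {p \<in> polys n. Poly_Mapping.keys p \<subseteq> U}"

abbreviation monom :: "(nat \<Rightarrow>\<^sub>0 nat) \<Rightarrow> 'k::comm_ring_1 mpoly" where
  "monom \<mu> \<equiv> Poly_Mapping.single \<mu> 1"

lemma keys_add_nat:
  fixes \<mu> \<nu> :: "'a \<Rightarrow>\<^sub>0 nat"
  shows "Poly_Mapping.keys (\<mu> + \<nu>) = Poly_Mapping.keys \<mu> \<union> Poly_Mapping.keys \<nu>"
  by (auto simp: in_keys_iff lookup_add)

interpretation polys: subring_on "polys n :: 'k::comm_ring_1 mpoly set" for n
proof
  show "1 \<in> (polys n :: 'k mpoly set)" by (simp add: polys_def)
  show "a - b \<in> polys n" if "a \<in> polys n" "b \<in> polys n" for a b :: "'k mpoly"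
    using that keys_diff[of a b] by (auto simp: polys_def)
  show "a * b \<in> polys n" if "a \<in> polys n" "b \<in> polys n" for a b :: "'k mpoly"
    using that keys_mult[of a b] by (fastforce simp: polys_def keys_add_nat)
qed

lemma monom_mem_polys [simp]:
  "(monom \<mu> :: 'k::comm_ring_1 mpoly) \<in> polys n \<longleftrightarrow> Poly_Mapping.keys \<mu> \<subseteq> {..n}"
  by (simp add: polys_def)

lemma poly_mapping_sum_single: "(\<Sum>\<mu>\<in>Poly_Mapping.keys p. Poly_Mapping.single \<mu> (Poly_Mapping.lookup p \<mu>)) = p"
  by (rule poly_mapping_eqI)
    (auto simp: lookup_sum lookup_single when_def in_keys_iff sum.delta')

lemma ideal_monomial_ideal:
  assumes up: "\<And>\<mu> \<nu>. \<mu> \<in> U \<Longrightarrow> \<nu> + \<mu> \<in> U"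
  shows "ideal (monomial_ideal n U :: 'k::comm_ring_1 mpoly set) (ring_on (polys n))"
proof (rule polys.idealI)
  show "a + b \<in> monomial_ideal n U"
    if "a \<in> monomial_ideal n U" "b \<in> monomial_ideal n U" for a b :: "'k mpoly"
    using that polys.add_mem keys_add[of a b] by (auto simp: monomial_ideal_def)
  show "a * b \<in> monomial_ideal n U"
    if "a \<in> polys n" "b \<in> monomial_ideal n U" for a b :: "'k mpoly"
    using that polys.mult_mem keys_mult[of a b] up by (fastforce simp: monomial_ideal_def)
qed (auto simp: monomial_ideal_def polys.zero_mem)

text \<open>A polynomial is the sum of its terms, each a constant times a monomial of
  \<open>J\<close>. Lower bounds for generated ideals and for products are thereby reduced to
  monomials.\<close>

lemma monomial_ideal_subset_ideal:
  fixes J :: "'k::comm_ring_1 mpoly set"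
  assumes J: "ideal J (ring_on (polys n))"
    and mem: "\<And>\<mu>. \<mu> \<in> U \<Longrightarrow> Poly_Mapping.keys \<mu> \<subseteq> {..n} \<Longrightarrow> monom \<mu> \<in> J"
  shows "monomial_ideal n U \<subseteq> J"
proof
  fix p :: "'k mpoly" assume p: "p \<in> monomial_ideal n U"
  have summand: "Poly_Mapping.single \<mu> (Poly_Mapping.lookup p \<mu>) \<in> J" if "\<mu> \<in> Poly_Mapping.keys p" for \<mu>
  proof -
    have "monom \<mu> \<in> J" using p that mem by (auto simp: monomial_ideal_def polys_def)
    moreover have "Poly_Mapping.single 0 (Poly_Mapping.lookup p \<mu>) \<in> polys n" by (simp add: polys_def)
    ultimately have "Poly_Mapping.single 0 (Poly_Mapping.lookup p \<mu>) * monom \<mu> \<in> J"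
      by (rule ideal_ring_onD(4)[OF J, rotated])
    then show ?thesis by (simp add: mult_single)
  qed
  have "(\<Sum>\<mu>\<in>B. Poly_Mapping.single \<mu> (Poly_Mapping.lookup p \<mu>)) \<in> J"
    if "B \<subseteq> Poly_Mapping.keys p" for B
    using finite_subset[OF that finite_keys] that
    by (induction B rule: finite_induct) (auto intro: ideal_ring_onD(2,3)[OF J] summand)
  then show "p \<in> J" using poly_mapping_sum_single[of p] by (metis order_refl)
qed

lemma genideal_monomials:
  assumes M: "\<And>\<mu>. \<mu> \<in> M \<Longrightarrow> Poly_Mapping.keys \<mu> \<subseteq> {..n}"
  shows "Idl\<^bsub>ring_on (polys n)\<^esub> (monom ` M :: 'k::comm_ring_1 mpoly set) =
    monomial_ideal n {\<nu> + \<mu> | \<nu> \<mu>. \<mu> \<in> M}" (is "_ = ?J")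
proof
  have "ideal ?J (ring_on (polys n))"
    by (rule ideal_monomial_ideal) (auto, metis add.assoc)
  moreover have "monom ` M \<subseteq> ?J"
    using M by (auto simp: monomial_ideal_def) (metis add_0)
  ultimately show "Idl\<^bsub>ring_on (polys n)\<^esub> (monom ` M) \<subseteq> ?J"
    by (auto simp: genideal_def)
  have "?J \<subseteq> J" if "ideal J (ring_on (polys n))" "monom ` M \<subseteq> J" for J :: "'k mpoly set"
  proof (rule monomial_ideal_subset_ideal[OF that(1)], clarify)
    fix \<nu> \<mu> assume "\<mu> \<in> M" "Poly_Mapping.keys (\<nu> + \<mu>) \<subseteq> {..n}"
    then have "monom \<nu> * monom \<mu> \<in> J"
      using that by (intro ideal_ring_onD(4)[OF that(1)]) (auto simp: keys_add_nat)
    then show "monom (\<nu> + \<mu>) \<in> J" by (simp add: mult_single)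
  qed
  then show "?J \<subseteq> Idl\<^bsub>ring_on (polys n)\<^esub> (monom ` M)"
    by (auto simp: genideal_def)
qed

text \<open>Every exponent of a product is a sum of exponents of the factors; conversely a monomial
  splits along such a sum.\<close>

lemma ideal_prod_monomial_ideal:
  assumes up: "\<And>\<mu> \<nu>. \<mu> \<in> U \<Longrightarrow> \<nu> + \<mu> \<in> U" "\<And>\<mu> \<nu>. \<mu> \<in> V \<Longrightarrow> \<nu> + \<mu> \<in> V"
  shows "ideal_prod (ring_on (polys n)) (monomial_ideal n U :: 'k::comm_ring_1 mpoly set) (monomial_ideal n V)
    = monomial_ideal n {\<mu> + \<nu> | \<mu> \<nu>. \<mu> \<in> U \<and> \<nu> \<in> V}" (is "?P = ?J")
proof
  interpret R: cring "ring_on (polys n :: 'k mpoly set)" by (rule polys.is_cring)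
  have ids: "ideal (monomial_ideal n U :: 'k mpoly set) (ring_on (polys n))"
      "ideal (monomial_ideal n V :: 'k mpoly set) (ring_on (polys n))"
    using up by (auto intro: ideal_monomial_ideal)
  show "?P \<subseteq> ?J"
  proof
    fix p assume "p \<in> ?P"
    then show "p \<in> ?J"
    proof induction
      case (prod i j)
      then show ?case
        using keys_mult[of i j] polys.mult_mem[of i n j] by (fastforce simp: monomial_ideal_def)
    next
      case (sum p q)
      then show ?case
        using keys_add[of p q] polys.add_mem[of p n q] by (auto simp: monomial_ideal_def)
    qed
  qed
  show "?J \<subseteq> ?P"
  proof (rule monomial_ideal_subset_ideal, goal_cases)
    case 1
    then show ?case by (rule R.ideal_prod_is_ideal[OF ids])
  next
    case (2 \<mu>)
    then obtain \<alpha> \<beta> where \<mu>: "\<mu> = \<alpha> + \<beta>" "\<alpha> \<in> U" "\<beta> \<in> V" by auto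
    then have "monom \<alpha> \<otimes>\<^bsub>ring_on (polys n)\<^esub> monom \<beta> \<in> ?P"
      using 2 by (intro ideal_prod.prod) (auto simp: monomial_ideal_def keys_add_nat)
    then show ?case by (simp add: \<mu> mult_single)
  qed
qed

subsection \<open>Weights\<close>

text \<open>For finite \<open>T\<close>, the order of vanishing of a monomial along the coordinate
  subspace where the variables with index in \<open>T\<close> vanish.\<close>

definition wt :: "nat set \<Rightarrow> (nat \<Rightarrow>\<^sub>0 nat) \<Rightarrow> nat" where
  "wt T \<mu> = (\<Sum>j\<in>T. Poly_Mapping.lookup \<mu> j)"

lemma wt_add: "wt T (\<mu> + \<nu>) = wt T \<mu> + wt T \<nu>"
  by (simp add: wt_def lookup_add sum.distrib)

text \<open>The parts of least weight of two factors multiply to a nonzero polynomial, so no cancellation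
  can raise the least weight of a product.\<close>

lemma weight_of_factor:
  fixes s p :: "'k::idom mpoly"
  assumes s: "\<mu> \<in> Poly_Mapping.keys s" "wt T \<mu> = 0"
    and sp: "\<And>\<mu>. \<mu> \<in> Poly_Mapping.keys (s * p) \<Longrightarrow> m \<le> wt T \<mu>"
    and \<nu>: "\<nu> \<in> Poly_Mapping.keys p"
  shows "m \<le> wt T \<nu>"
proof (rule ccontr)
  assume "\<not> m \<le> wt T \<nu>"
  \<comment> \<open>\<open>d\<close> is the least weight in \<open>p\<close>. The negated claim
    gives \<open>d < m\<close>, and a term of weight \<open>d\<close> will be shown to survive in
    \<open>s * p\<close>.\<close>
  define d where "d = (LEAST k. \<exists>\<nu>\<in>Poly_Mapping.keys p. wt T \<nu> = k)"
  have "\<exists>\<nu>\<in>Poly_Mapping.keys p. wt T \<nu> = d"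
    unfolding d_def by (rule LeastI_ex) (use \<nu> in auto)
  then obtain \<nu>0 where \<nu>0: "\<nu>0 \<in> Poly_Mapping.keys p" "wt T \<nu>0 = d" by auto
  have d_le: "d \<le> wt T \<beta>" if "\<beta> \<in> Poly_Mapping.keys p" for \<beta>
    unfolding d_def by (rule Least_le) (use that in auto)
  then have "d < m" using \<nu> \<open>\<not> m \<le> wt T \<nu>\<close> by fastforce
  define part where "part k q = (\<Sum>\<mu>\<in>{\<mu> \<in> Poly_Mapping.keys q. wt T \<mu> = k}.
      Poly_Mapping.single \<mu> (Poly_Mapping.lookup q \<mu>))" for k and q :: "'k mpoly"
  have lookup_part: "Poly_Mapping.lookup (part k q) \<mu> = (Poly_Mapping.lookup q \<mu> when wt T \<mu> = k)" for k q \<mu>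
    by (auto simp: part_def lookup_sum lookup_single when_def in_keys_iff sum.delta')
  have "part 0 s \<noteq> 0"
    using s lookup_part[of 0 s \<mu>] by (auto simp: in_keys_iff)
  moreover have "part d p \<noteq> 0"
    using \<nu>0 lookup_part[of d p \<nu>0] by (auto simp: in_keys_iff)
  ultimately have "part 0 s * part d p \<noteq> 0" by simp
  then obtain \<gamma> where \<gamma>: "\<gamma> \<in> Poly_Mapping.keys (part 0 s * part d p)"
    by (meson keys_eq_empty all_not_in_conv)
  then obtain \<alpha> \<beta> where "\<gamma> = \<alpha> + \<beta>" "\<alpha> \<in> Poly_Mapping.keys (part 0 s)" "\<beta> \<in> Poly_Mapping.keys (part d p)"
    using keys_mult by blast
  then have wt\<gamma>: "wt T \<gamma> = d"
    by (auto simp: wt_add in_keys_iff lookup_part when_def split: if_splits)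
  have rest: "\<gamma> \<notin> Poly_Mapping.keys (q * r)"
    if "\<And>\<alpha> \<beta>. \<alpha> \<in> Poly_Mapping.keys q \<Longrightarrow> \<beta> \<in> Poly_Mapping.keys r \<Longrightarrow> d < wt T \<alpha> + wt T \<beta>"
    for q r :: "'k mpoly"
    using keys_mult[of q r] that wt\<gamma> by (fastforce simp: wt_add)
  \<comment> \<open>The last two summands have only terms of weight above \<open>d\<close>, so they
    cannot cancel the term at \<open>\<gamma>\<close>.\<close>
  have "s * p = part 0 s * part d p + part 0 s * (p - part d p) + (s - part 0 s) * p"
    by (simp add: algebra_simps)
  moreover have "\<gamma> \<notin> Poly_Mapping.keys (part 0 s * (p - part d p))"
    using d_le by (intro rest) (auto simp: in_keys_iff lookup_minus lookup_part when_def
        order.not_eq_order_implies_strict split: if_splits intro!: trans_less_add2 le_neq_implies_less)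
  moreover have "\<gamma> \<notin> Poly_Mapping.keys ((s - part 0 s) * p)"
  proof (rule rest)
    fix \<alpha> \<beta> assume "\<alpha> \<in> Poly_Mapping.keys (s - part 0 s)" "\<beta> \<in> Poly_Mapping.keys p"
    then have "wt T \<alpha> > 0" "d \<le> wt T \<beta>"
      using d_le by (auto simp: in_keys_iff lookup_minus lookup_part when_def split: if_splits)
    then show "d < wt T \<alpha> + wt T \<beta>" by linarith
  qed
  ultimately have "\<gamma> \<in> Poly_Mapping.keys (s * p)"
    using \<gamma> by (simp add: in_keys_iff lookup_add)
  then show False using sp wt\<gamma> \<open>d < m\<close> by fastforce
qed

subsection \<open>The ideal and its powers\<close>

lemma wt_pos_iff: "finite T \<Longrightarrow> 0 < wt T \<mu> \<longleftrightarrow> (\<exists>j\<in>T. 0 < Poly_Mapping.lookup \<mu> j)"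
  unfolding wt_def neq0_conv[symmetric] by (simp del: neq0_conv)

text \<open>
  The exponents of the monomials of \<open>I\<^sup>m\<close>: the number \<open>c\<close> counts the factors
  \<open>x\<^sub>0 \<cdots> x\<^sub>n\<^sub>-\<^sub>1\<close>, and \<open>m - c\<close> factors \<open>x\<^sub>i x\<^sub>n\<close> can be taken from the rest as soon
  as the exponent of \<open>x\<^sub>n\<close> and the remaining total exponent of the other variables allow it.
\<close>

definition power_exps :: "nat \<Rightarrow> nat \<Rightarrow> (nat \<Rightarrow>\<^sub>0 nat) set" where
  "power_exps n m = {\<mu>. \<exists>c. (\<forall>i<n. c \<le> Poly_Mapping.lookup \<mu> i) \<and>
     m \<le> c + Poly_Mapping.lookup \<mu> n \<and> m + n * c \<le> c + wt {..<n} \<mu>}"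

lemma power_exps_0: "power_exps n 0 = UNIV"
  by (auto simp: power_exps_def intro: exI[of _ 0])

text \<open>All three conditions are linear in the exponents and the count, so the counts
  \<open>c\<close> and \<open>d\<close> add.\<close>

lemma power_exps_add:
  assumes "\<mu> \<in> power_exps n m" "\<nu> \<in> power_exps n k"
  shows "\<mu> + \<nu> \<in> power_exps n (m + k)"
proof -
  obtain c d where
    "\<forall>i<n. c \<le> Poly_Mapping.lookup \<mu> i" "m \<le> c + Poly_Mapping.lookup \<mu> n" "m + n * c \<le> c + wt {..<n} \<mu>"
    "\<forall>i<n. d \<le> Poly_Mapping.lookup \<nu> i" "k \<le> d + Poly_Mapping.lookup \<nu> n" "k + n * d \<le> d + wt {..<n} \<nu>"
    using assms by (auto simp: power_exps_def)
  then show ?thesis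
    unfolding power_exps_def
    by (intro CollectI exI[of _ "c + d"]) (auto simp: lookup_add wt_add algebra_simps intro: add_mono)
qed

lemma power_exps_up: "\<mu> \<in> power_exps n m \<Longrightarrow> \<nu> + \<mu> \<in> power_exps n m"
  using power_exps_add[of \<nu> n 0 \<mu> m] by (simp add: power_exps_0)

text \<open>For finite \<open>B\<close>, the exponent vector of the squarefree monomial with support
  \<open>B\<close>.\<close>

definition indic :: "nat set \<Rightarrow> nat \<Rightarrow>\<^sub>0 nat" where
  "indic B = (\<Sum>j\<in>B. Poly_Mapping.single j 1)"

lemma lookup_indic: "finite B \<Longrightarrow> Poly_Mapping.lookup (indic B) i = (if i \<in> B then 1 else 0)"
  by (simp add: indic_def lookup_sum lookup_single when_def)

lemma keys_indic: "finite B \<Longrightarrow> Poly_Mapping.keys (indic B) = B"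
  by (auto simp: in_keys_iff lookup_indic split: if_splits)

lemma wt_indic: "finite B \<Longrightarrow> wt T (indic B) = (if finite T then card (T \<inter> B) else 0)"
  by (simp add: wt_def lookup_indic sum.If_cases)

lemma monom_indic:
  "finite B \<Longrightarrow> (monom (indic B) :: 'k::comm_ring_1 mpoly) = (\<Prod>j\<in>B. mvar j)"
proof (induction B rule: finite_induct)
  case (insert j B)
  have "(monom (indic (insert j B)) :: 'k mpoly) = mvar j * monom (indic B)"
    using insert(1,2)
    by (simp add: indic_def mvar_def mult_single)
  then show ?case using insert by simp
qed (simp add: indic_def)

definition gens :: "nat \<Rightarrow> (nat \<Rightarrow>\<^sub>0 nat) set" where
  "gens n = insert (indic {..<n}) ((\<lambda>i. indic {i, n}) ` {..<n})"

lemma keys_gens: "\<mu> \<in> gens n \<Longrightarrow> Poly_Mapping.keys \<mu> \<subseteq> {..n}"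
  by (auto simp: gens_def keys_indic)

lemma gens_mem_power_exps: "\<mu> \<in> gens n \<Longrightarrow> \<mu> \<in> power_exps n 1"
  unfolding gens_def power_exps_def
proof (elim insertE imageE)
  \<comment> \<open>The product \<open>x\<^sub>0 \<cdots> x\<^sub>n\<^sub>-\<^sub>1\<close> needs
    the count \<open>c = 1\<close>, a generator \<open>x\<^sub>i x\<^sub>n\<close> the count
    \<open>c = 0\<close>.\<close>
  assume "\<mu> = indic {..<n}"
  then show "\<mu> \<in> {\<mu>. \<exists>c. (\<forall>i<n. c \<le> Poly_Mapping.lookup \<mu> i) \<and>
     1 \<le> c + Poly_Mapping.lookup \<mu> n \<and> 1 + n * c \<le> c + wt {..<n} \<mu>}"
    by (auto simp: lookup_indic wt_indic intro!: exI[of _ 1])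
next
  fix i assume "\<mu> = indic {i, n}" "i \<in> {..<n}"
  then show "\<mu> \<in> {\<mu>. \<exists>c. (\<forall>i<n. c \<le> Poly_Mapping.lookup \<mu> i) \<and>
     1 \<le> c + Poly_Mapping.lookup \<mu> n \<and> 1 + n * c \<le> c + wt {..<n} \<mu>}"
    by (auto simp: lookup_indic wt_indic intro!: exI[of _ 0])
qed

text \<open>A generator can be split off: the product of the variables if \<open>c > 0\<close>, otherwise some
  \<open>x\<^sub>i x\<^sub>n\<close>.\<close>

lemma power_exps_Suc_split:
  assumes "\<mu> \<in> power_exps n (Suc m)"
  obtains \<nu> \<gamma> where "\<mu> = \<nu> + \<gamma>" "\<nu> \<in> power_exps n m" "\<gamma> \<in> gens n"
proof -
  obtain c where c: "\<forall>i<n. c \<le> Poly_Mapping.lookup \<mu> i" "Suc m \<le> c + Poly_Mapping.lookup \<mu> n"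
      "Suc m + n * c \<le> c + wt {..<n} \<mu>"
    using assms by (auto simp: power_exps_def)
  obtain \<gamma> d where \<gamma>: "\<gamma> \<in> gens n" "\<forall>i. Poly_Mapping.lookup \<gamma> i \<le> Poly_Mapping.lookup \<mu> i"
    and d: "\<forall>i<n. d + Poly_Mapping.lookup \<gamma> i \<le> Poly_Mapping.lookup \<mu> i"
      "m + Poly_Mapping.lookup \<gamma> n \<le> d + Poly_Mapping.lookup \<mu> n"
      "m + n * d + wt {..<n} \<gamma> \<le> d + wt {..<n} \<mu>"
  proof (cases c)
    case 0
    then have "0 < wt {..<n} \<mu>" using c by simp
    then obtain i where i: "i < n" "0 < Poly_Mapping.lookup \<mu> i"
      by (auto simp: wt_pos_iff)
    have "{..<n} \<inter> {i, n} = {i}" using i by auto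
    then show thesis
      using c i 0 by (intro that[of "indic {i, n}" 0]) (auto simp: gens_def lookup_indic wt_indic)
  next
    case (Suc d)
    then show thesis
      using c by (intro that[of "indic {..<n}" d]) (auto simp: gens_def lookup_indic wt_indic)
  qed
  \<comment> \<open>Truncated subtraction is undone by addition because \<open>\<gamma>\<close> lies
    pointwise below \<open>\<mu>\<close>.\<close>
  have \<mu>: "\<mu> = (\<mu> - \<gamma>) + \<gamma>"
    using \<gamma>(2) by (intro poly_mapping_eqI) (simp add: lookup_add lookup_minus)
  have lk: "Poly_Mapping.lookup \<mu> i = Poly_Mapping.lookup (\<mu> - \<gamma>) i + Poly_Mapping.lookup \<gamma> i" for i
    by (subst \<mu>) (simp add: lookup_add)
  have "wt {..<n} \<mu> = wt {..<n} (\<mu> - \<gamma>) + wt {..<n} \<gamma>"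
    by (subst \<mu>) (simp add: wt_add)
  then have "\<mu> - \<gamma> \<in> power_exps n m"
    unfolding power_exps_def using d lk by (intro CollectI exI[of _ d]) auto
  then show thesis using that \<mu> \<gamma>(1) by blast
qed

text \<open>Mirrors the recursion of \<open>ideal_power\<close> on exponents: a generator splits off
  in one direction, \<open>power_exps_add\<close> gives the other.\<close>

lemma power_exps_Suc:
  "power_exps n (Suc m) = {\<mu> + \<nu> | \<mu> \<nu>. \<mu> \<in> power_exps n m \<and> \<nu> \<in> power_exps n 1}"
proof (intro equalityI subsetI)
  fix \<mu> assume "\<mu> \<in> power_exps n (Suc m)"
  then show "\<mu> \<in> {\<mu> + \<nu> | \<mu> \<nu>. \<mu> \<in> power_exps n m \<and> \<nu> \<in> power_exps n 1}"
    by (rule power_exps_Suc_split) (use gens_mem_power_exps in blast)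
qed (use power_exps_add[of _ n m _ 1] in auto)

lemma power_exps_1: "power_exps n 1 = {\<nu> + \<mu> | \<nu> \<mu>. \<mu> \<in> gens n}"
proof (intro equalityI subsetI)
  fix \<mu> assume "\<mu> \<in> power_exps n 1"
  then have "\<mu> \<in> power_exps n (Suc 0)" by simp
  then show "\<mu> \<in> {\<nu> + \<mu> | \<nu> \<mu>. \<mu> \<in> gens n}"
    by (rule power_exps_Suc_split) auto
qed (auto intro: power_exps_up gens_mem_power_exps simp del: One_nat_def)

lemma genideal_gens:
  "Idl\<^bsub>ring_on (polys n)\<^esub> ((\<lambda>i. mvar i * mvar n) ` {..<n} \<union> {\<Prod>i<n. mvar i}) =
    (monomial_ideal n (power_exps n 1) :: 'k::comm_ring_1 mpoly set)"
proof -
  have "(\<lambda>i. mvar i * mvar n) ` {..<n} \<union> {\<Prod>i<n. mvar i} = (monom ` gens n :: 'k mpoly set)"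
    by (auto simp: gens_def monom_indic image_image)
  then show ?thesis
    by (simp only: genideal_monomials[OF keys_gens] power_exps_1)
qed

lemma ideal_power_monomial:
  "ideal_power (polys n) (monomial_ideal n (power_exps n 1)) m =
    (monomial_ideal n (power_exps n m) :: 'k::comm_ring_1 mpoly set)"
proof (induction m)
  case 0
  show ?case by (simp add: ideal_power_0 power_exps_0 monomial_ideal_def)
next
  case (Suc m)
  then show ?case
    by (simp only: ideal_power_Suc power_exps_Suc ideal_prod_monomial_ideal[OF power_exps_up power_exps_up])
qed

subsection \<open>Components\<close>

text \<open>The component \<open>P\<^sub>i\<close> is generated by the variables with index in one of these sets.\<close>

definition components :: "nat \<Rightarrow> nat set set" where
  "components n = insert {..<n} ((\<lambda>i. {i, n}) ` {..<n})"

lemma components_finite: "T \<in> components n \<Longrightarrow> finite T"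
  by (auto simp: components_def)

lemma wt_pair: "i < n \<Longrightarrow> wt {i, n} \<mu> = Poly_Mapping.lookup \<mu> i + Poly_Mapping.lookup \<mu> n"
  by (simp add: wt_def)

text \<open>Encoded by positive weight instead of generators, so that primality becomes the case
  \<open>m = 1\<close> of \<open>weight_of_factor\<close>.\<close>

definition prime_component :: "nat \<Rightarrow> nat set \<Rightarrow> 'k::comm_ring_1 mpoly set" where
  "prime_component n T = monomial_ideal n {\<mu>. 0 < wt T \<mu>}"

lemma genideal_vars:
  assumes "T \<subseteq> {..n}"
  shows "Idl\<^bsub>ring_on (polys n)\<^esub> (mvar ` T) = (prime_component n T :: 'k::comm_ring_1 mpoly set)"
proof -
  have T: "finite T" using assms finite_subset by blast
  have "(mvar ` T :: 'k mpoly set) = monom ` ((\<lambda>j. Poly_Mapping.single j 1) ` T)"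
    by (auto simp: mvar_def)
  moreover have "{\<nu> + \<mu> | \<nu> \<mu>. \<mu> \<in> (\<lambda>j. Poly_Mapping.single j 1) ` T} = {\<mu>. 0 < wt T \<mu>}"
  proof (intro equalityI subsetI)
    fix \<mu> assume "\<mu> \<in> {\<mu>. 0 < wt T \<mu>}"
    then obtain j where j: "j \<in> T" "0 < Poly_Mapping.lookup \<mu> j"
      using T by (auto simp: wt_pos_iff)
    have "\<mu> = (\<mu> - Poly_Mapping.single j 1) + Poly_Mapping.single j 1"
      using j by (intro poly_mapping_eqI) (auto simp: lookup_add lookup_minus lookup_single when_def)
    then show "\<mu> \<in> {\<nu> + \<mu> | \<nu> \<mu>. \<mu> \<in> (\<lambda>j. Poly_Mapping.single j 1) ` T}"
      using j by blast
  qed (use T in \<open>auto simp: wt_pos_iff lookup_add lookup_single when_def\<close>)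
  ultimately show ?thesis
    using assms by (simp only: prime_component_def) (subst genideal_monomials, auto)
qed

text \<open>This is the primary decomposition on exponents. If \<open>x\<^sub>n\<close> does not
  occur, the pairs \<open>{i, n}\<close> force all other variables to occur; if it does, one
  variable from \<open>{..<n}\<close> completes a generator. Conversely every generator meets every
  component.\<close>

lemma power_exps_1_iff:
  assumes "0 < n"
  shows "\<mu> \<in> power_exps n 1 \<longleftrightarrow> (\<forall>T\<in>components n. 0 < wt T \<mu>)"
proof
  assume "\<mu> \<in> power_exps n 1"
  then obtain \<nu> \<gamma> where "\<mu> = \<nu> + \<gamma>" "\<gamma> \<in> gens n" by (auto simp: power_exps_1 simp del: One_nat_def)
  moreover from this have "0 < wt T \<gamma>" if "T \<in> components n" for T
    using that assms by (auto simp: gens_def components_def wt_pos_iff lookup_indic)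
  ultimately show "\<forall>T\<in>components n. 0 < wt T \<mu>" by (simp add: wt_add)
next
  assume pos: "\<forall>T\<in>components n. 0 < wt T \<mu>"
  then have S: "0 < wt {..<n} \<mu>" by (simp add: components_def)
  show "\<mu> \<in> power_exps n 1"
  proof (cases "Poly_Mapping.lookup \<mu> n = 0")
    case False
    with S show ?thesis by (auto simp: power_exps_def intro!: exI[of _ 0])
  next
    case True
    then have "\<forall>i<n. 1 \<le> Poly_Mapping.lookup \<mu> i"
      using pos by (auto simp: components_def wt_pair Suc_le_eq)
    moreover from this have "n \<le> wt {..<n} \<mu>"
      using sum_mono[of "{..<n}" "\<lambda>_. 1" "Poly_Mapping.lookup \<mu>"] by (simp add: wt_def)
    ultimately show ?thesis by (auto simp: power_exps_def intro!: exI[of _ 1])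
  qed
qed

lemma monomial_ideal_eq_Inter:
  assumes "0 < n"
  shows "monomial_ideal n (power_exps n 1) = (\<Inter>T\<in>components n. prime_component n T :: 'k::comm_ring_1 mpoly set)"
proof -
  have "power_exps n 1 = (\<Inter>T\<in>components n. {\<mu>. 0 < wt T \<mu>})"
    using power_exps_1_iff[OF assms] by blast
  \<comment> \<open>An empty intersection would be the whole type rather than
    \<open>polys n\<close>.\<close>
  moreover have "components n \<noteq> {}" by (simp add: components_def)
  moreover have "(\<Inter>T\<in>components n. prime_component n T :: 'k mpoly set) =
    monomial_ideal n (\<Inter>T\<in>components n. {\<mu>. 0 < wt T \<mu>})" if "components n \<noteq> {}"
    using that by (auto simp: prime_component_def monomial_ideal_def)
  ultimately show ?thesis by simp
qed

lemma I_Z_monomial: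
  assumes "0 < n"
  shows "I_Z n = (monomial_ideal n (power_exps n 1) :: 'k::field mpoly set)"
proof -
  have "Idl\<^bsub>ring_on (polys n)\<^esub> {mvar i, mvar n} = (prime_component n {i, n} :: 'k mpoly set)"
    if "i < n" for i
    using that genideal_vars[of "{i, n}" n, where 'k = 'k] by simp
  moreover have "Idl\<^bsub>ring_on (polys n)\<^esub> (mvar ` {..<n}) = (prime_component n {..<n} :: 'k mpoly set)"
    by (rule genideal_vars) auto
  ultimately show ?thesis
    by (simp add: I_Z_def monomial_ideal_eq_Inter[OF assms] components_def Int_commute del: One_nat_def)
qed

section \<open>Primality of the components and their association to the ideal\<close>

lemma keys_mult_monom:
  fixes p :: "'k::idom mpoly"
  shows "Poly_Mapping.keys (p * monom \<nu>) = (\<lambda>\<mu>. \<mu> + \<nu>) ` Poly_Mapping.keys p"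
proof
  show "Poly_Mapping.keys (p * monom \<nu>) \<subseteq> (\<lambda>\<mu>. \<mu> + \<nu>) ` Poly_Mapping.keys p"
    using keys_mult[of p "monom \<nu>"] by auto
  \<comment> \<open>Shifting by \<open>\<nu>\<close> is injective on exponents, so no two terms
    merge and each coefficient is kept.\<close>
  have "Poly_Mapping.lookup (p * monom \<nu>) (\<mu> + \<nu>) = Poly_Mapping.lookup p \<mu>" for \<mu>
  proof -
    have "p * monom \<nu> = (\<Sum>\<kappa>\<in>Poly_Mapping.keys p. Poly_Mapping.single (\<kappa> + \<nu>) (Poly_Mapping.lookup p \<kappa>))"
      by (subst (1) poly_mapping_sum_single[symmetric]) (simp add: sum_distrib_right mult_single)
    then show ?thesis
      by (auto simp: lookup_sum lookup_single when_def in_keys_iff sum.delta)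
  qed
  then show "(\<lambda>\<mu>. \<mu> + \<nu>) ` Poly_Mapping.keys p \<subseteq> Poly_Mapping.keys (p * monom \<nu>)"
    by (auto simp: in_keys_iff)
qed

text \<open>A factor outside the ideal has a term of weight zero; by \<open>weight_of_factor\<close>
  every term of the other factor then has positive weight.\<close>

lemma prime_component_primeideal:
  "primeideal (prime_component n T :: 'k::idom mpoly set) (ring_on (polys n))"
proof (rule primeidealI)
  show "ideal (prime_component n T :: 'k mpoly set) (ring_on (polys n))"
    unfolding prime_component_def by (rule ideal_monomial_ideal) (simp add: wt_add)
  show "cring (ring_on (polys n :: 'k mpoly set))" by (rule polys.is_cring)
  have "(1 :: 'k mpoly) \<notin> prime_component n T"
    by (simp add: prime_component_def monomial_ideal_def wt_def)
  then show "carrier (ring_on (polys n)) \<noteq> (prime_component n T :: 'k mpoly set)"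
    using polys.one_mem by auto
next
  fix a b :: "'k mpoly"
  assume ab: "a \<in> carrier (ring_on (polys n))" "b \<in> carrier (ring_on (polys n))"
    "a \<otimes>\<^bsub>ring_on (polys n)\<^esub> b \<in> prime_component n T"
  show "a \<in> prime_component n T \<or> b \<in> prime_component n T"
  proof (cases "a \<in> prime_component n T")
    case False
    then obtain \<mu> where "\<mu> \<in> Poly_Mapping.keys a" "wt T \<mu> = 0"
      using ab by (auto simp: prime_component_def monomial_ideal_def)
    then have "0 < wt T \<nu>" if "\<nu> \<in> Poly_Mapping.keys b" for \<nu>
      using weight_of_factor[of \<mu> a T b 1, OF _ _ _ that] ab
      by (auto simp: prime_component_def monomial_ideal_def Suc_le_eq)
    then have "Poly_Mapping.keys b \<subseteq> {\<nu>. 0 < wt T \<nu>}" by blast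
    then show ?thesis using ab by (simp add: prime_component_def monomial_ideal_def)
  qed simp
qed

text \<open>Here \<open>2 \<le> n\<close> is essential: for \<open>n = 1\<close> the component
  \<open>{0}\<close> lies inside \<open>{0, 1}\<close>.\<close>

lemma components_incomparable:
  assumes n: "2 \<le> n" and S: "S \<in> components n" and T: "T \<in> components n" and "S \<noteq> T"
  shows "\<exists>j\<in>S. j \<le> n \<and> j \<notin> T"
proof (cases "T = {..<n}")
  case True
  then show ?thesis using S \<open>S \<noteq> T\<close> by (auto simp: components_def)
next
  case False
  then obtain i where i: "T = {i, n}" using T by (auto simp: components_def)
  show ?thesis
  proof (cases "S = {..<n}")
    case True
    define j :: nat where "j = (if i = 0 then 1 else 0)"
    have "j < n" "j \<noteq> i" using n by (auto simp: j_def)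
    then show ?thesis using True i by (intro bexI[of _ j]) auto
  next
    case False
    then obtain k where "S = {k, n}" "k < n" using S by (auto simp: components_def)
    then show ?thesis using i \<open>S \<noteq> T\<close> by auto
  qed
qed

lemma prime_component_assoc:
  assumes "2 \<le> n" "T \<in> components n"
  shows "(prime_component n T :: 'k::idom mpoly set) \<in>
    assoc_primes (polys n) (monomial_ideal n (power_exps n 1))"
proof -
  \<comment> \<open>The product of the variables outside \<open>T\<close> leaves the weight on
    \<open>T\<close> unchanged and, by incomparability, makes all other component weights positive.
    The ideal quotient by it is therefore exactly the component of \<open>T\<close>.\<close>
  define \<nu> where "\<nu> = indic ({..n} - T)"
  have "0 < wt S (\<mu> + \<nu>)" if "S \<in> components n" "0 < wt T \<mu>" for \<mu> S
  proof (cases "S = T")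
    case False
    then have "S \<inter> ({..n} - T) \<noteq> {}"
      using components_incomparable[OF assms(1) that(1) assms(2)] by blast
    then show ?thesis
      using components_finite[OF that(1)] by (simp add: wt_add \<nu>_def wt_indic) (auto simp: card_gt_0_iff)
  qed (use that in \<open>simp add: wt_add\<close>)
  moreover have "wt T (\<mu> + \<nu>) = wt T \<mu>" for \<mu>
    using components_finite[OF assms(2)] by (simp add: wt_add \<nu>_def wt_indic)
  ultimately have \<nu>: "\<mu> + \<nu> \<in> power_exps n 1 \<longleftrightarrow> 0 < wt T \<mu>" for \<mu>
    using assms by (auto simp: power_exps_1_iff simp del: One_nat_def)
  have "Poly_Mapping.keys \<nu> \<subseteq> {..n}" by (simp add: \<nu>_def keys_indic)
  then have "(monom \<nu> :: 'k mpoly) \<in> polys n" by simp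
  moreover from this have "prime_component n T =
      {a \<in> polys n. a * (monom \<nu> :: 'k mpoly) \<in> monomial_ideal n (power_exps n 1)}"
    using \<nu> polys.mult_mem[of _ n "monom \<nu> :: 'k mpoly"]
    by (auto simp: prime_component_def monomial_ideal_def keys_mult_monom)
  ultimately show ?thesis
    unfolding assoc_primes_def using prime_component_primeideal by blast
qed

subsection \<open>Localization\<close>

lemma primeideal_ring_onD:
  assumes "primeideal P (ring_on A)"
  shows "0 \<in> P" "P \<subseteq> A" "1 \<in> A \<Longrightarrow> 1 \<notin> P"
    "\<And>a b. a \<in> A - P \<Longrightarrow> b \<in> A - P \<Longrightarrow> a * b \<notin> P"
proof -
  interpret primeideal P "ring_on A" by fact
  show "0 \<in> P" "P \<subseteq> A" using ideal_ring_onD(1,2)[OF is_ideal] by auto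
  show "1 \<notin> P" if "1 \<in> A"
  proof
    assume "1 \<in> P"
    then have "A \<subseteq> P" using ideal_ring_onD(4)[OF is_ideal, of _ 1] by auto
    then show False using I_notcarr \<open>P \<subseteq> A\<close> by auto
  qed
  show "a * b \<notin> P" if "a \<in> A - P" "b \<in> A - P" for a b
    using I_prime[of a b] that by auto
qed

lemma subring_on_localization:
  fixes A :: "'a::idom set"
  assumes A: "subring_on A" and P: "primeideal P (ring_on A)"
  shows "subring_on (localization A P)"
proof
  interpret subring_on A by fact
  note prime = primeideal_ring_onD[OF P]
  show "1 \<in> localization A P"
    unfolding localization_def One_fract_def using prime(3) one_mem by blast
  fix x y assume "x \<in> localization A P" "y \<in> localization A P"
  then obtain a s b t where x: "x = Fract a s" "a \<in> A" "s \<in> A - P"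
    and y: "y = Fract b t" "b \<in> A" "t \<in> A - P"
    by (auto simp: localization_def)
  have st: "s * t \<in> A - P" "s \<noteq> 0" "t \<noteq> 0"
    using x y prime(1,4) mult_mem by auto
  have "x - y = Fract (a * t - b * s) (s * t)" "x * y = Fract (a * b) (s * t)"
    using x y st by auto
  moreover have "a * t - b * s \<in> A" "a * b \<in> A"
    using x y by (auto intro: diff_mem mult_mem)
  ultimately show "x - y \<in> localization A P" "x * y \<in> localization A P"
    using st(1) unfolding localization_def by blast+
qed

text \<open>Clearing a single denominator describes the contraction of a localized ideal, so
  symbolic powers can be studied inside \<open>A\<close>.\<close>

lemma mem_extended_ideal_iff:
  fixes A :: "'a::idom set"
  assumes A: "subring_on A" and P: "primeideal P (ring_on A)" and J: "ideal J (ring_on A)"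
  shows "Fract x 1 \<in> extended_ideal A P J \<longleftrightarrow> (\<exists>s\<in>A - P. s * x \<in> J)"
proof
  interpret subring_on A by fact
  interpret L: subring_on "localization A P" by (rule subring_on_localization[OF A P])
  note prime = primeideal_ring_onD[OF P]
  note J = ideal_ring_onD[OF J]
  \<comment> \<open>The fractions with numerator in \<open>J\<close> form an ideal of the
    localization, which contains the generated one; equality with \<open>Fract x 1\<close> is then
    cross-multiplied.\<close>
  define H where "H = {Fract a s | a s. a \<in> J \<and> s \<in> A - P}"
  have one: "1 \<in> A - P" using one_mem prime(3) by auto
  have "ideal H (ring_on (localization A P))"
  proof (rule L.idealI)
    show "H \<subseteq> localization A P" using J(1) by (auto simp: H_def localization_def)
    show "0 \<in> H" unfolding H_def Zero_fract_def using J(2) one by blast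
  next
    fix x y assume "x \<in> H" "y \<in> H"
    then obtain a s b t where x: "x = Fract a s" "a \<in> J" "s \<in> A - P"
      and y: "y = Fract b t" "b \<in> J" "t \<in> A - P"
      by (auto simp: H_def)
    then have st: "s * t \<in> A - P" "s \<noteq> 0" "t \<noteq> 0"
      using prime(1,4) mult_mem by auto
    then have "x + y = Fract (t * a + s * b) (s * t)" using x y by (simp add: mult.commute)
    moreover have "t * a + s * b \<in> J" using x y J(3,4) by auto
    ultimately show "x + y \<in> H" unfolding H_def using st(1) by blast
  next
    fix x y assume "x \<in> localization A P" "y \<in> H"
    then obtain a s b t where x: "x = Fract a s" "a \<in> A" "s \<in> A - P"
      and y: "y = Fract b t" "b \<in> J" "t \<in> A - P"
      by (auto simp: H_def localization_def)
    then have "s * t \<in> A - P" using prime(4) mult_mem by auto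
    moreover have "x * y = Fract (a * b) (s * t)" "a * b \<in> J" using x y J(4) by auto
    ultimately show "x * y \<in> H" unfolding H_def by blast
  qed
  moreover have "(\<lambda>a. Fract a 1) ` J \<subseteq> H" unfolding H_def using one by blast
  moreover assume "Fract x 1 \<in> extended_ideal A P J"
  ultimately have "Fract x 1 \<in> H" by (auto simp: extended_ideal_def genideal_def)
  then obtain a s where "Fract x 1 = Fract a s" "a \<in> J" "s \<in> A - P" by (auto simp: H_def)
  moreover from this have "s \<noteq> 0" using prime(1) by auto
  ultimately have "s * x = a" "s \<in> A - P" by (auto simp: eq_fract mult.commute)
  then show "\<exists>s\<in>A - P. s * x \<in> J" using \<open>a \<in> J\<close> by auto
next
  assume "\<exists>s\<in>A - P. s * x \<in> J"
  then obtain s where s: "s \<in> A - P" "s * x \<in> J" by auto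
  then have "s \<noteq> 0" using primeideal_ring_onD(1)[OF P] by auto
  have "Fract x 1 \<in> H" if H: "ideal H (ring_on (localization A P))" "(\<lambda>a. Fract a 1) ` J \<subseteq> H" for H
  proof -
    have "Fract 1 s \<in> localization A P"
      unfolding localization_def using s subring_on.one_mem[OF A] by blast
    then have "Fract 1 s * Fract (s * x) 1 \<in> H"
      using ideal_ring_onD(4)[OF H(1)] H(2) s by blast
    moreover have "Fract (s * x) s = Fract x 1" using \<open>s \<noteq> 0\<close> by (simp add: eq_fract)
    ultimately show ?thesis by simp
  qed
  then show "Fract x 1 \<in> extended_ideal A P J"
    by (auto simp: extended_ideal_def genideal_def)
qed

subsection \<open>Symbolic powers\<close>

text \<open>Inverting the variables outside \<open>T\<close> turns \<open>I\<close> into \<open>P\<^sub>T\<close>.\<close>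

lemma clear_denominators:
  assumes n: "2 \<le> n" and T: "T \<in> components n" and \<mu>: "m \<le> wt T \<mu>"
  shows "(\<Sum>j\<in>{..n} - T. Poly_Mapping.single j (2 * m)) + \<mu> \<in> power_exps n m"
proof -
  define \<nu> where "\<nu> = (\<Sum>j\<in>{..n} - T. Poly_Mapping.single j (2 * m))"
  have lk: "Poly_Mapping.lookup \<nu> j = (if j \<in> {..n} - T then 2 * m else 0)" for j
    by (simp add: \<nu>_def lookup_sum lookup_single when_def)
  consider "T = {..<n}" | i where "i < n" "T = {i, n}"
    using T by (auto simp: components_def)
  then have "\<nu> + \<mu> \<in> power_exps n m"
  proof cases
    case 1
    then have "Poly_Mapping.lookup (\<nu> + \<mu>) n \<ge> m" by (simp add: lookup_add lk)
    moreover have "m \<le> wt {..<n} (\<nu> + \<mu>)" using \<mu> 1 by (simp add: wt_add)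
    ultimately show ?thesis by (auto simp: power_exps_def intro!: exI[of _ 0])
  next
    case 2
    \<comment> \<open>As many full products are taken as \<open>x\<^sub>i\<close> allows, at most
      \<open>m\<close>. The exponent \<open>2 * m\<close> of the other variables pays for these and
      for the \<open>m - c\<close> partners of \<open>x\<^sub>n\<close>.\<close>
    define c where "c = min m (Poly_Mapping.lookup \<mu> i)"
    have "wt {..<n} (\<nu> + \<mu>) = wt {..<n} \<nu> + wt {..<n} \<mu>" by (rule wt_add)
    moreover have "wt {..<n} \<nu> = (n - 1) * (2 * m)"
    proof -
      have "wt {..<n} \<nu> = (\<Sum>j\<in>{..<n} - {i}. 2 * m)"
        unfolding wt_def using 2 by (intro sum.mono_neutral_cong_right) (auto simp: lk)
      then show ?thesis using 2 by (simp add: card_Diff_singleton)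
    qed
    moreover have "c \<le> wt {..<n} \<mu>"
      using 2 member_le_sum[of i "{..<n}" "Poly_Mapping.lookup \<mu>"] by (simp add: wt_def c_def)
    moreover have "m + n * c \<le> c + ((n - 1) * (2 * m) + c)"
    proof -
      obtain k where k: "n = Suc (Suc k)" using n by (metis add_2_eq_Suc le_Suc_ex)
      have "c \<le> m" by (simp add: c_def)
      then have "c * k \<le> m * k" by (rule mult_le_mono1)
      also have "\<dots> \<le> m + k * (m * 2)" by simp
      finally show ?thesis using \<open>c \<le> m\<close> k by (simp add: algebra_simps)
    qed
    ultimately have "m + n * c \<le> c + wt {..<n} (\<nu> + \<mu>)" by linarith
    moreover have "m \<le> c + Poly_Mapping.lookup (\<nu> + \<mu>) n"
      using \<mu> 2 by (simp add: wt_pair c_def lookup_add)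
    moreover have "c \<le> Poly_Mapping.lookup (\<nu> + \<mu>) j" if "j < n" for j
      using that 2 by (auto simp: c_def lookup_add lk)
    ultimately show ?thesis by (auto simp: power_exps_def)
  qed
  then show ?thesis by (simp add: \<nu>_def)
qed

text \<open>As \<open>1\<close> is not in \<open>P\<close>, the element \<open>f\<close> lies
  outside some component. For \<open>a\<close> in \<open>P\<close> the product \<open>a * f\<close>
  lies in that component, and primality puts \<open>a\<close> there.\<close>

lemma assoc_prime_subset_component:
  fixes P :: "'k::idom mpoly set"
  assumes n: "0 < n" and P: "P \<in> assoc_primes (polys n) (monomial_ideal n (power_exps n 1))"
  obtains T where "T \<in> components n" "P \<subseteq> prime_component n T"
proof -
  have mem: "p \<in> monomial_ideal n (power_exps n 1) \<longleftrightarrow> (\<forall>T\<in>components n. p \<in> prime_component n T)"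
    for p :: "'k mpoly"
    using monomial_ideal_eq_Inter[OF n, where 'k = 'k] by blast
  from P obtain f where prime: "primeideal P (ring_on (polys n))" and f: "f \<in> polys n"
    and eq: "P = {a \<in> polys n. a * f \<in> monomial_ideal n (power_exps n 1)}"
    by (auto simp: assoc_primes_def simp del: One_nat_def)
  have "1 \<notin> P" using primeideal_ring_onD(3)[OF prime polys.one_mem] .
  then have "f \<notin> monomial_ideal n (power_exps n 1)" using eq polys.one_mem by auto
  then obtain T where T: "T \<in> components n" "f \<notin> prime_component n T" using mem by blast
  have "P \<subseteq> prime_component n T"
  proof
    fix a assume "a \<in> P"
    then have "a \<in> polys n" "a * f \<in> prime_component n T" using eq mem T(1) by auto
    then show "a \<in> prime_component n T"
      using primeideal_ring_onD(4)[OF prime_component_primeideal[of n T], of a f] f T(2) by auto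
  qed
  then show thesis using that T(1) by blast
qed

text \<open>A denominator outside the component of \<open>T\<close> has a term of weight zero, so
  localizing there yields the weight bound on \<open>T\<close>. Conversely, an associated prime lies
  in some component, and a monomial outside that component clears the denominators.\<close>

lemma symbolic_power_monomial:
  assumes n: "2 \<le> n"
  shows "symbolic_power (polys n) (monomial_ideal n (power_exps n 1)) m =
    (monomial_ideal n {\<mu>. \<forall>T\<in>components n. m \<le> wt T \<mu>} :: 'k::idom mpoly set)"
    (is "symbolic_power _ ?I m = ?S")
proof (intro equalityI subsetI)
  have ideal: "ideal (monomial_ideal n (power_exps n m) :: 'k mpoly set) (ring_on (polys n))"
    by (rule ideal_monomial_ideal) (rule power_exps_up)
  note ext = mem_extended_ideal_iff[OF polys.subring_on_axioms _ ideal]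
  {
    fix p :: "'k mpoly" assume "p \<in> symbolic_power (polys n) ?I m"
    then have p: "p \<in> polys n" and
      p_ext: "\<And>P. P \<in> assoc_primes (polys n) ?I \<Longrightarrow>
        Fract p 1 \<in> extended_ideal (polys n) P (monomial_ideal n (power_exps n m))"
      by (auto simp: symbolic_power_def ideal_power_monomial simp del: One_nat_def)
    have "m \<le> wt T \<mu>" if T: "T \<in> components n" and \<mu>: "\<mu> \<in> Poly_Mapping.keys p" for T \<mu>
    proof -
      have "prime_component n T \<in> assoc_primes (polys n) ?I"
        using n T by (intro prime_component_assoc) auto
      then obtain s where s: "s \<in> polys n - prime_component n T"
          "s * p \<in> monomial_ideal n (power_exps n m)"
        using p_ext ext[OF prime_component_primeideal] by blast
      then obtain \<alpha> where "\<alpha> \<in> Poly_Mapping.keys s" "wt T \<alpha> = 0"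
        by (auto simp: prime_component_def monomial_ideal_def)
      moreover have "m \<le> wt T \<beta>" if "\<beta> \<in> Poly_Mapping.keys (s * p)" for \<beta>
      proof -
        have "\<beta> \<in> power_exps n m" using that s(2) by (auto simp: monomial_ideal_def)
        then obtain c where c: "\<forall>i<n. c \<le> Poly_Mapping.lookup \<beta> i"
            "m \<le> c + Poly_Mapping.lookup \<beta> n" "m + n * c \<le> c + wt {..<n} \<beta>"
          by (auto simp: power_exps_def)
        \<comment> \<open>Terms of the ordinary power satisfy every weight bound: this inequality
          settles \<open>{..<n}\<close>, and \<open>c\<close> being below each exponent settles the
          pairs.\<close>
        have "c \<le> n * c" using n by simp
        then have "m \<le> wt {..<n} \<beta>" using c(3) by linarith
        moreover have "m \<le> wt {i, n} \<beta>" if "i < n" for i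
          using c that by (fastforce simp: wt_pair)
        ultimately show ?thesis using T by (auto simp: components_def)
      qed
      ultimately show ?thesis using \<mu> by (rule weight_of_factor)
    qed
    then show "p \<in> ?S" using p by (auto simp: monomial_ideal_def)
  next
    fix p :: "'k mpoly" assume p: "p \<in> ?S"
    then have "p \<in> polys n" by (simp add: monomial_ideal_def)
    have "Fract p 1 \<in> extended_ideal (polys n) P (monomial_ideal n (power_exps n m))"
      if P: "P \<in> assoc_primes (polys n) ?I" for P
    proof -
      obtain T where T: "T \<in> components n" "P \<subseteq> prime_component n T"
        using assoc_prime_subset_component[OF _ P] n by auto
      define \<nu> where "\<nu> = (\<Sum>j\<in>{..n} - T. Poly_Mapping.single j (2 * m))"
      have lk: "Poly_Mapping.lookup \<nu> j = (if j \<in> {..n} - T then 2 * m else 0)" for j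
        by (simp add: \<nu>_def lookup_sum lookup_single when_def)
      have keys: "Poly_Mapping.keys \<nu> \<subseteq> {..n}" by (auto simp: in_keys_iff lk split: if_splits)
      have "wt T \<nu> = 0" by (simp add: wt_def lk)
      then have "(monom \<nu> :: 'k mpoly) \<notin> prime_component n T"
        by (simp add: prime_component_def monomial_ideal_def)
      then have "(monom \<nu> :: 'k mpoly) \<in> polys n - P" using T(2) keys by auto
      moreover have "p * monom \<nu> \<in> monomial_ideal n (power_exps n m)"
        using p T(1) clear_denominators[OF n T(1)] polys.mult_mem[OF \<open>p \<in> polys n\<close>, of "monom \<nu>"] keys
        by (fastforce simp: monomial_ideal_def keys_mult_monom \<nu>_def add.commute)
      moreover have "primeideal P (ring_on (polys n))" using P by (simp add: assoc_primes_def)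
      ultimately show ?thesis by (subst ext) (auto simp: mult.commute)
    qed
    then show "p \<in> symbolic_power (polys n) ?I m"
      using \<open>p \<in> polys n\<close> by (auto simp: symbolic_power_def ideal_power_monomial simp del: One_nat_def)
  }
qed

subsection \<open>Containments\<close>

text \<open>
  The number of factors is concave in \<open>c\<close>, with its maximum where \<open>S - n c = u\<close>; if that \<open>c\<close>
  is admissible, the rounded-down value is \<open>(S + (n - 1) u) div n\<close>.
\<close>

lemma symbolic_exps_subset_power_exps:
  assumes n: "2 \<le> n" and \<mu>: "\<forall>T\<in>components n. m \<le> wt T \<mu>"
    and s: "s * n\<^sup>2 \<le> m * (n\<^sup>2 - n + 1)"
  shows "\<mu> \<in> power_exps n s"
proof -
  define u S where "u = Poly_Mapping.lookup \<mu> n" and "S = wt {..<n} \<mu>"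
  define t where "t = Min (Poly_Mapping.lookup \<mu> ` {..<n})"
  have t_le: "t \<le> Poly_Mapping.lookup \<mu> i" if "i < n" for i
    unfolding t_def using that by (intro Min_le) auto
  have "t \<in> Poly_Mapping.lookup \<mu> ` {..<n}"
    unfolding t_def using n by (intro Min_in) (auto simp: lessThan_empty_iff)
  then obtain i where "i < n" "t = Poly_Mapping.lookup \<mu> i" by auto
  then have tu: "m \<le> t + u" and S: "m \<le> S"
    using \<mu> by (auto simp: components_def wt_pair u_def S_def)
  have nt: "n * t \<le> S"
    using sum_mono[of "{..<n}" "\<lambda>_. t" "Poly_Mapping.lookup \<mu>"] t_le by (simp add: S_def wt_def)
  obtain k where k: "n = Suc k" using n by (cases n) auto
  have nn: "n\<^sup>2 - n + 1 = n * k + 1" by (simp add: k power2_eq_square)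
  have "n\<^sup>2 - n + 1 \<le> n\<^sup>2" using n by (simp add: k power2_eq_square)
  then have "s * n\<^sup>2 \<le> m * n\<^sup>2" using s by (meson le_trans mult_le_mono2)
  then have sm: "s \<le> m" using n by simp
  have witness: "\<mu> \<in> power_exps n s" if "c \<le> t" "s \<le> c + u" "s + n * c \<le> c + S" for c
    using that t_le unfolding power_exps_def u_def S_def by (intro CollectI exI[of _ c]) (auto intro: le_trans)
  \<comment> \<open>The balancing point \<open>(S - u) / n\<close> is at most \<open>0\<close>, at
    least \<open>t\<close>, or strictly between; the count is chosen as \<open>0\<close>, as
    \<open>t\<close>, or as the point rounded down.\<close>
  consider "S \<le> u" | "n * t + u \<le> S" | "u < S" "S < n * t + u" by linarith
  then show ?thesis
  proof cases
    case 1
    then show ?thesis using sm S by (intro witness[of 0]) auto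
  next
    case 2
    then show ?thesis using sm tu by (intro witness[of t]) auto
  next
    case 3
    define c where "c = (S - u) div n"
    have c: "n * c \<le> S - u" "S - u < n * c + n"
      using n by (auto simp: c_def) (metis add.commute dividend_less_times_div gr0I not_numeral_le_zero)
    have "n * c < n * t" using c 3 by linarith
    then have ct: "c \<le> t" by simp
    \<comment> \<open>By \<open>m \<le> t + u\<close> it suffices to bound
      \<open>n * k * t + m\<close> by \<open>n * S\<close>. If \<open>n * t \<le> m\<close>, it is
      at most \<open>n * m\<close>, otherwise at most \<open>n * (n * t)\<close>; both are at most
      \<open>n * S\<close>.\<close>
    have weighted: "m * (n * k + 1) \<le> n * (S + k * u)"
    proof -
      have A: "k * m \<le> k * t + k * u" using tu by (metis add_mult_distrib2 mult_le_mono2)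
      show ?thesis
      proof (cases "n * t \<le> m")
        case True
        then have "k * (n * t) \<le> k * m" by simp
        moreover have "n * (k * m) \<le> n * (k * t + k * u)" using A by simp
        moreover have "n * m \<le> n * S" using S by simp
        ultimately show ?thesis using k by (simp add: algebra_simps)
      next
        case False
        have "n * (k * m) \<le> n * (k * t + k * u)" using A by simp
        moreover have "n * (n * t) \<le> n * S" using nt by simp
        ultimately show ?thesis using False k by (simp add: algebra_simps)
      qed
    qed
    have "n * (n * s) = s * n\<^sup>2" by (simp add: power2_eq_square)
    also note s
    also have "m * (n\<^sup>2 - n + 1) = m * (n * k + 1)" by (simp only: nn)
    also note weighted
    finally have "n * (n * s) \<le> n * (S + k * u)" .
    then have "n * s \<le> S + k * u" using n by simp
    \<comment> \<open>Rounding \<open>c\<close> down costs less than \<open>n\<close>, which the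
      strict inequality absorbs after division by \<open>n\<close>.\<close>
    also have "S + k * u < n * (c + u) + n" using c 3 k by (simp add: algebra_simps)
    finally have "n * s < n * (c + u + 1)" by (simp add: algebra_simps)
    then have "s < c + u + 1" by (simp only: mult_less_cancel1)
    then have "s \<le> c + u" by simp
    \<comment> \<open>Since \<open>n * c \<le> S - u\<close>, the exponent \<open>u\<close> is the
      scarcer resource and the first bound implies the second.\<close>
    moreover have "s + n * c \<le> c + S" using \<open>s \<le> c + u\<close> c 3 by linarith
    ultimately show ?thesis using ct by (intro witness[of c])
  qed
qed

text \<open>All component weights equal \<open>n\<^sup>2 * k\<close>. At \<open>c = k\<close> both
  bounds on the power meet at \<open>(n\<^sup>2 - n + 1) * k\<close>; a smaller \<open>c\<close>
  lowers one of them, a larger \<open>c\<close> the other.\<close>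

lemma extremal_exps:
  assumes n: "2 \<le> n"
  obtains \<mu> where "Poly_Mapping.keys \<mu> \<subseteq> {..n}" "\<forall>T\<in>components n. n\<^sup>2 * k \<le> wt T \<mu>"
    "\<mu> \<notin> power_exps n ((n\<^sup>2 - n + 1) * k + 1)"
proof -
  obtain j where j: "n = Suc j" using n by (cases n) auto
  define \<mu> where "\<mu> = (\<Sum>i<n. Poly_Mapping.single i (n * k)) + Poly_Mapping.single n (n * j * k)"
  have lk: "Poly_Mapping.lookup \<mu> i = (if i < n then n * k else if i = n then n * j * k else 0)" for i
    by (auto simp: \<mu>_def lookup_add lookup_sum lookup_single when_def)
  have wt: "wt {..<n} \<mu> = n\<^sup>2 * k" by (simp add: wt_def lk power2_eq_square)
  have nn: "(n\<^sup>2 - n + 1) * k = n * j * k + k" by (simp add: j power2_eq_square)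
  show thesis
  proof
    show "Poly_Mapping.keys \<mu> \<subseteq> {..n}" by (auto simp: in_keys_iff lk split: if_splits)
    show "\<forall>T\<in>components n. n\<^sup>2 * k \<le> wt T \<mu>"
      by (auto simp: components_def wt wt_pair lk) (simp add: j power2_eq_square algebra_simps)
    show "\<mu> \<notin> power_exps n ((n\<^sup>2 - n + 1) * k + 1)"
    proof
      assume "\<mu> \<in> power_exps n ((n\<^sup>2 - n + 1) * k + 1)"
      then have "\<mu> \<in> power_exps n (n * j * k + k + 1)" by (simp only: nn)
      then obtain c where c: "n * j * k + k + 1 \<le> c + n * j * k" "n * j * k + k + 1 + n * c \<le> c + n\<^sup>2 * k"
        by (auto simp: power_exps_def lk wt)
      have "j * (k + 1) \<le> j * c" using c(1) by (intro mult_le_mono2) simp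
      then show False using c(2) j by (simp add: power2_eq_square algebra_simps)
    qed
  qed
qed

lemma monomial_ideal_mono: "U \<subseteq> V \<Longrightarrow> monomial_ideal n U \<subseteq> monomial_ideal n V"
  by (auto simp: monomial_ideal_def)

lemma power_exps_antimono:
  assumes "k \<le> m"
  shows "power_exps n m \<subseteq> power_exps n k"
proof
  fix \<mu> assume "\<mu> \<in> power_exps n m"
  then obtain c where "\<forall>i<n. c \<le> Poly_Mapping.lookup \<mu> i"
      "m \<le> c + Poly_Mapping.lookup \<mu> n" "m + n * c \<le> c + wt {..<n} \<mu>"
    by (auto simp: power_exps_def)
  then show "\<mu> \<in> power_exps n k"
    using assms unfolding power_exps_def by (intro CollectI exI[of _ c]) auto
qed

lemma symbolic_power_subset:
  assumes n: "2 \<le> n" and "s * n\<^sup>2 \<le> m * (n\<^sup>2 - n + 1)"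
  shows "symbolic_power (polys n) (I_Z n :: 'k::field mpoly set) m \<subseteq> ideal_power (polys n) (I_Z n) s"
proof -
  have "I_Z n = (monomial_ideal n (power_exps n 1) :: 'k mpoly set)"
    using n by (intro I_Z_monomial) simp
  then show ?thesis
    using symbolic_exps_subset_power_exps[OF n _ assms(2)]
    by (simp only: symbolic_power_monomial[OF n] ideal_power_monomial) (auto intro!: monomial_ideal_mono)
qed

text \<open>Admitting every larger \<open>r\<close>, by \<open>power_exps_antimono\<close>, makes
  the bound applicable to scaled exponents in the asymptotic case.\<close>

lemma symbolic_power_not_subset:
  assumes n: "2 \<le> n" and r: "(n\<^sup>2 - n + 1) * k < r"
  shows "\<not> symbolic_power (polys n) (I_Z n :: 'k::field mpoly set) (n\<^sup>2 * k) \<subseteq> ideal_power (polys n) (I_Z n) r"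
proof
  have I: "I_Z n = (monomial_ideal n (power_exps n 1) :: 'k mpoly set)"
    using n by (intro I_Z_monomial) simp
  assume "symbolic_power (polys n) (I_Z n :: 'k mpoly set) (n\<^sup>2 * k) \<subseteq> ideal_power (polys n) (I_Z n) r"
  then have sub: "(monomial_ideal n {\<mu>. \<forall>T\<in>components n. n\<^sup>2 * k \<le> wt T \<mu>} :: 'k mpoly set)
      \<subseteq> monomial_ideal n (power_exps n r)"
    by (simp only: I symbolic_power_monomial[OF n] ideal_power_monomial)
  obtain \<mu> where \<mu>: "Poly_Mapping.keys \<mu> \<subseteq> {..n}" "\<forall>T\<in>components n. n\<^sup>2 * k \<le> wt T \<mu>"
    "\<mu> \<notin> power_exps n ((n\<^sup>2 - n + 1) * k + 1)"
    by (rule extremal_exps[OF n])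
  have "(monom \<mu> :: 'k mpoly) \<in> monomial_ideal n {\<mu>. \<forall>T\<in>components n. n\<^sup>2 * k \<le> wt T \<mu>}"
    using \<mu> by (simp add: monomial_ideal_def)
  then have "(monom \<mu> :: 'k mpoly) \<in> monomial_ideal n (power_exps n r)" using sub by blast
  then have "\<mu> \<in> power_exps n r" by (simp add: monomial_ideal_def)
  then show False using \<mu>(3) power_exps_antimono[of "(n\<^sup>2 - n + 1) * k + 1" r n] r by auto
qed

section \<open>Resurgence and asymptotic resurgence\<close>

lemma resurgence_exponents:
  assumes "2 \<le> n"
  shows "0 < (real n)\<^sup>2 - real n + 1" "real (n\<^sup>2 - n + 1) = (real n)\<^sup>2 - real n + 1"
proof -
  \<comment> \<open>This makes the truncated subtraction \<open>n\<^sup>2 - n\<close> agree with the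
    real one.\<close>
  have "n \<le> n\<^sup>2" by (simp add: power2_eq_square)
  then show eq: "real (n\<^sup>2 - n + 1) = (real n)\<^sup>2 - real n + 1" by (simp add: of_nat_diff)
  show "0 < (real n)\<^sup>2 - real n + 1" unfolding eq[symmetric] by simp
qed

lemma ratio_ge_iff:
  assumes "2 \<le> n" "0 < s"
  shows "(real n)\<^sup>2 / ((real n)\<^sup>2 - real n + 1) \<le> real m / real s \<longleftrightarrow> s * n\<^sup>2 \<le> m * (n\<^sup>2 - n + 1)"
proof -
  have "(real n)\<^sup>2 / ((real n)\<^sup>2 - real n + 1) \<le> real m / real s
      \<longleftrightarrow> real (s * n\<^sup>2) \<le> real (m * (n\<^sup>2 - n + 1))"
    using assms(2) resurgence_exponents(1)[OF assms(1)]
    unfolding of_nat_mult resurgence_exponents(2)[OF assms(1)]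
    by (simp add: divide_simps mult.commute)
  then show ?thesis by (simp only: of_nat_le_iff)
qed

text \<open>The ratios of the failing containments: \<open>Suc k\<close> keeps the symbolic exponent
  positive, and dividing by it turns the extra \<open>1\<close> into a vanishing term.\<close>

lemma ratios_tendsto:
  assumes "2 \<le> n"
  shows "(\<lambda>k. ereal (real (n\<^sup>2 * Suc k) / real ((n\<^sup>2 - n + 1) * Suc k + 1)))
    \<longlonglongrightarrow> ereal ((real n)\<^sup>2 / ((real n)\<^sup>2 - real n + 1))"
proof -
  define q where "q = (real n)\<^sup>2 - real n + 1"
  have q: "0 < q" "real (n\<^sup>2 - n + 1) = q"
    using resurgence_exponents[OF assms] by (simp_all add: q_def)
  have "(\<lambda>k. (real n)\<^sup>2 / (q + inverse (real (Suc k)))) \<longlonglongrightarrow> (real n)\<^sup>2 / (q + 0)"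
    using q by (intro tendsto_intros LIMSEQ_inverse_real_of_nat) auto
  moreover have "real (n\<^sup>2 * Suc k) / real ((n\<^sup>2 - n + 1) * Suc k + 1)
      = (real n)\<^sup>2 / (q + inverse (real (Suc k)))" for k
  proof -
    define z where "z = real (Suc k)"
    have z: "0 < z" by (simp add: z_def)
    have "real (N * Suc k + 1) = real N * z + 1" for N
      by (simp add: z_def algebra_simps)
    then have "real ((n\<^sup>2 - n + 1) * Suc k + 1) = q * z + 1"
      by (simp only: q(2))
    also have "\<dots> = (q + inverse z) * z"
      using z by (simp add: distrib_right)
    finally have "real ((n\<^sup>2 - n + 1) * Suc k + 1) = (q + inverse z) * z" .
    moreover have "real (n\<^sup>2 * Suc k) = (real n)\<^sup>2 * z" by (simp only: z_def of_nat_mult of_nat_power)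
    ultimately show ?thesis using z by (simp add: z_def[symmetric] del: of_nat_Suc)
  qed
  ultimately show ?thesis by (simp add: q_def)
qed

text \<open>One positive \<open>t\<close> from the eventual failure suffices, because
  \<open>m * t\<close> and \<open>r * t\<close> have the same ratio as \<open>m\<close> and
  \<open>r\<close>.\<close>

lemma asymptotic_resurgence_le_resurgence: "asymptotic_resurgence A J \<le> resurgence A J"
  unfolding asymptotic_resurgence_def
proof (rule Sup_least, clarify)
  fix m r :: nat
  assume mr: "0 < m" "0 < r"
    and ev: "\<forall>\<^sub>F t in sequentially. \<not> symbolic_power A J (m * t) \<subseteq> ideal_power A J (r * t)"
  obtain t where t: "0 < t" "\<not> symbolic_power A J (m * t) \<subseteq> ideal_power A J (r * t)"
    using eventually_happens'[OF _ eventually_conj[OF ev eventually_gt_at_top[of 0]]] by auto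
  have "ereal (real (m * t) / real (r * t)) \<le> resurgence A J"
    unfolding resurgence_def using mr t by (intro Sup_upper CollectI exI conjI) auto
  then show "ereal (real m / real r) \<le> resurgence A J" using t by simp
qed

lemma resurgence_I_Z_le:
  assumes n: "2 \<le> n"
  shows "resurgence (polys n) (I_Z n :: 'k::field mpoly set) \<le> ereal ((real n)\<^sup>2 / ((real n)\<^sup>2 - real n + 1))"
  unfolding resurgence_def
proof (rule Sup_least, elim CollectE exE conjE)
  fix x m r
  assume "0 < r" "\<not> symbolic_power (polys n) (I_Z n :: 'k mpoly set) m \<subseteq> ideal_power (polys n) (I_Z n) r"
    and x: "x = ereal (real m / real r)"
  then have "\<not> (real n)\<^sup>2 / ((real n)\<^sup>2 - real n + 1) \<le> real m / real r"
    using symbolic_power_subset[OF n] ratio_ge_iff[OF n \<open>0 < r\<close>] by blast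
  then show "x \<le> ereal ((real n)\<^sup>2 / ((real n)\<^sup>2 - real n + 1))" by (simp add: x)
qed

lemma asymptotic_resurgence_I_Z_ge:
  assumes n: "2 \<le> n"
  shows "ereal ((real n)\<^sup>2 / ((real n)\<^sup>2 - real n + 1)) \<le> asymptotic_resurgence (polys n) (I_Z n :: 'k::field mpoly set)"
proof (rule LIMSEQ_le_const2[OF ratios_tendsto[OF n]], intro exI allI impI)
  fix k :: nat
  let ?m = "n\<^sup>2 * Suc k" and ?r = "(n\<^sup>2 - n + 1) * Suc k + 1"
  have "\<not> symbolic_power (polys n) (I_Z n :: 'k mpoly set) (?m * t) \<subseteq> ideal_power (polys n) (I_Z n) (?r * t)"
    if "0 < t" for t
  proof -
    \<comment> \<open>The extra \<open>1\<close> in \<open>?r\<close> becomes \<open>t\<close> under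
      scaling, which keeps the inequality strict.\<close>
    have "(n\<^sup>2 - n + 1) * (Suc k * t) < ?r * t" using that by (simp add: algebra_simps)
    then show ?thesis using symbolic_power_not_subset[OF n] by (simp only: mult.assoc)
  qed
  then have "\<forall>\<^sub>F t in sequentially. \<not> symbolic_power (polys n) (I_Z n :: 'k mpoly set) (?m * t)
      \<subseteq> ideal_power (polys n) (I_Z n) (?r * t)"
    by (intro eventually_mono[OF eventually_gt_at_top[of 0]])
  moreover have "0 < ?m" "0 < ?r" using n by auto
  ultimately show "ereal (real ?m / real ?r) \<le> asymptotic_resurgence (polys n) (I_Z n :: 'k mpoly set)"
    unfolding asymptotic_resurgence_def by (intro Sup_upper CollectI exI conjI) (rule refl, assumption+)
qed

theorem theorem7p14:
  fixes n :: nat and I :: "'k::alg_closed_field mpoly set"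
  assumes "n \<ge> 2"
    and "I = Idl\<^bsub>ring_on (polys n)\<^esub>
               ((\<lambda>i. mvar i * mvar n) ` {..<n} \<union> {\<Prod>i<n. mvar i})"
  shows "I = I_Z n
    \<and> (\<forall>m s :: nat. m > 0 \<longrightarrow> s > 0 \<longrightarrow>
         real m / real s \<ge> (real n)\<^sup>2 / ((real n)\<^sup>2 - real n + 1) \<longrightarrow>
         symbolic_power (polys n) I m \<subseteq> ideal_power (polys n) I s)
    \<and> (\<forall>k :: nat. \<not> symbolic_power (polys n) I (n\<^sup>2 * k)
                   \<subseteq> ideal_power (polys n) I ((n\<^sup>2 - n + 1) * k + 1))
    \<and> resurgence (polys n) (I_Z n :: 'k mpoly set)
        = ereal ((real n)\<^sup>2 / ((real n)\<^sup>2 - real n + 1))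
    \<and> asymptotic_resurgence (polys n) (I_Z n :: 'k mpoly set)
        = ereal ((real n)\<^sup>2 / ((real n)\<^sup>2 - real n + 1))"
proof -
  have I: "I = I_Z n"
    using assms(1) I_Z_monomial[of n, where 'k = 'k] by (simp only: assms(2) genideal_gens)
  \<comment> \<open>The constant bounds the asymptotic resurgence from below and the resurgence from
    above, so both inequalities between them collapse.\<close>
  have "resurgence (polys n) (I_Z n :: 'k mpoly set) = ereal ((real n)\<^sup>2 / ((real n)\<^sup>2 - real n + 1))"
    "asymptotic_resurgence (polys n) (I_Z n :: 'k mpoly set) = ereal ((real n)\<^sup>2 / ((real n)\<^sup>2 - real n + 1))"
    using resurgence_I_Z_le[OF assms(1), where 'k = 'k] asymptotic_resurgence_I_Z_ge[OF assms(1), where 'k = 'k]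
      asymptotic_resurgence_le_resurgence[of "polys n" "I_Z n :: 'k mpoly set"]
    by (auto intro: antisym order_trans)
  moreover have "symbolic_power (polys n) I m \<subseteq> ideal_power (polys n) I s"
    if "0 < s" "(real n)\<^sup>2 / ((real n)\<^sup>2 - real n + 1) \<le> real m / real s" for m s
    unfolding I using that symbolic_power_subset[OF assms(1)] ratio_ge_iff[OF assms(1)] by blast
  moreover have "\<not> symbolic_power (polys n) I (n\<^sup>2 * k) \<subseteq> ideal_power (polys n) I ((n\<^sup>2 - n + 1) * k + 1)"
    for k
    unfolding I by (rule symbolic_power_not_subset[OF assms(1)]) simp
  ultimately show ?thesis using I by blast
qed

end
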